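(* Two matrices $M, N \in \mathbb{R}^{2\times 2}$ are LCP equivalent if $M_{12}\cdot N_{12} > 0$, $M_{21}\cdot N_{21} > 0$, and $\det(M_{\alpha\alpha})\cdot\det(N_{\alpha\alpha}) > 0$ for all $\alpha\subseteq\{1,2\}$.
   Context: $M_{\alpha\alpha}$ denotes the principal submatrix of $M$ with rows and columns indexed by $\alpha$ (with the usual convention that the determinant of the empty matrix is $1$). For $M \in \mathbb{R}^{n\times n}$ and $\alpha \subseteq \{1,\dots,n\}$, the complementary matrix $C_M(\alpha)\in\mathbb{R}^{n\times n}$ is the matrix whose $j$-th column is $-M_{\cdot j}$ if $j\in\alpha$ and $I_{\cdot j}$ if $j\notin\alpha$, where $I$ is the identity matrix and the subscript $\cdot j$ denotes the $j$-th column. $\operatorname{pos} A$ denotes the convex cone generated by the columns of $A$ (all nonnegative linear combinations). In particular the cones $\operatorname{pos} C_I(\alpha)$ are the $2^n$ closed orthants of $\mathbb{R}^n$. The piecewise linear map $f_M:\mathbb{R}^n\to\mathbb{R}^n$ is defined by $f_M(x) = C_{-M}(\alpha)x$ for $x \in \operatorname{pos} C_I(\alpha)$. A field of sets $(X,\mathcal{F})$ consists of a set $X$ and $\mathcal{F}\subset\mathcal{P}(X)$ closed under intersections of pairs of sets and complements of individual sets; the field generated by $\mathcal{G}\subset\mathcal{P}(X)$ is the intersection of all fields of sets (on $X$) containing $\mathcal{G}$. $\mathcal{F}_I$ is the field of sets on $\mathbb{R}^n$ generated by the closed orthants $\{\operatorname{pos} C_I(\alpha)\}_{\alpha}$. A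 Boolean automorphism of a field $(X,\mathcal{F})$ is a one-to-one mapping $h$ of $\mathcal{F}$ onto itself such that $h(P_1\cap P_2)=h(P_1)\cap h(P_2)$ and $h(-P_1)=-h(P_1)$ for all $P_1,P_2\in\mathcal{F}$, where $-P$ is the complement of $P$. It is induced by a mapping $\psi:X\to X$ if $h(P)=\psi^{-1}(P)$ (preimage) for every $P\in\mathcal{F}$. Two matrices $M,N\in\mathbb{R}^{n\times n}$ are LCP equivalent, written $M\sim N$, if there exist homeomorphisms $\varphi,\psi:\mathbb{R}^n\to\mathbb{R}^n$ such that $f_M=\varphi\circ f_N\circ\psi$, where $\psi$ induces a Boolean automorphism on $\mathcal{F}_I$. *)

theory Defs
  imports "HOL-Analysis.Analysis"
begin

text \<open>The Leibniz formula of \<^const>\<open>det\<close> with the index set cut down to \<open>\<alpha>\<close>, because a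
  subset \<open>\<alpha>\<close> of the index type is not itself an index type.\<close>

definition principal_minor :: "real^'n^'n \<Rightarrow> 'n::finite set \<Rightarrow> real" where
  "principal_minor M \<alpha> =
     (\<Sum>p | p permutes \<alpha>. of_int (sign p) * (\<Prod>i\<in>\<alpha>. M $ i $ p i))"

definition compl_matrix :: "real^'n^'n \<Rightarrow> 'n::finite set \<Rightarrow> real^'n^'n" where
  "compl_matrix M \<alpha> = (\<chi> i j. if j \<in> \<alpha> then - (M $ i $ j) else mat 1 $ i $ j)"

definition pos :: "real^'n^'m \<Rightarrow> (real^'m) set" where
  "pos A = convex_cone hull (columns A)"

definition orthants :: "(real^'n::finite) set set" where
  "orthants = range (\<lambda>\<alpha>. pos (compl_matrix (mat 1) \<alpha>))"

text \<open>The definite description is proper: on overlapping orthants the linear pieces agree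
  (lemma \<open>lcp_map_eq\<close> below).\<close>

definition lcp_map :: "real^'n^'n \<Rightarrow> real^'n \<Rightarrow> real^'n::finite" where
  "lcp_map M x =
     (THE y. \<forall>\<alpha>. x \<in> pos (compl_matrix (mat 1) \<alpha>) \<longrightarrow> y = compl_matrix (- M) \<alpha> *v x)"

text \<open>A field of sets is an \<^const>\<open>algebra\<close>. The latter also requires \<open>{}\<close> to be a member,
  which only excludes the empty family and so does not affect the field generated by a
  nonempty family.\<close>

definition generated_field :: "'a set set \<Rightarrow> 'a set set" where
  "generated_field G = algebra UNIV hull G"

definition orthant_field :: "(real^'n::finite) set set" where
  "orthant_field = generated_field orthants"

definition boolean_automorphism :: "'a set set \<Rightarrow> ('a set \<Rightarrow> 'a set) \<Rightarrow> bool" where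
  "boolean_automorphism F h \<longleftrightarrow>
     bij_betw h F F \<and>
     (\<forall>P\<in>F. \<forall>Q\<in>F. h (P \<inter> Q) = h P \<inter> h Q) \<and>
     (\<forall>P\<in>F. h (- P) = - h P)"

definition induces_automorphism :: "('a \<Rightarrow> 'a) \<Rightarrow> 'a set set \<Rightarrow> bool" where
  "induces_automorphism \<psi> F \<longleftrightarrow>
     (\<exists>h. boolean_automorphism F h \<and> (\<forall>P\<in>F. h P = \<psi> -` P))"

definition lcp_equivalent :: "real^'n^'n \<Rightarrow> real^'n^'n::finite \<Rightarrow> bool" where
  "lcp_equivalent M N \<longleftrightarrow>
     (\<exists>\<phi> \<phi>' \<psi> \<psi>'. homeomorphism UNIV UNIV \<phi> \<phi>' \<and> homeomorphism UNIV UNIV \<psi> \<psi>' \<and>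
        induces_automorphism \<psi> orthant_field \<and>
        lcp_map M = \<phi> \<circ> lcp_map N \<circ> \<psi>)"

lemma principal_minor_empty: "principal_minor M {} = 1"
  by (simp add: principal_minor_def permutes_empty sign_id)

lemma principal_minor_singleton: "principal_minor M {i} = M $ i $ i"
  by (simp add: principal_minor_def permutes_sing sign_id)

lemma principal_minor_UNIV: "principal_minor M UNIV = det M"
  by (simp add: principal_minor_def det_def)

lemma pos_eq: "pos A = {A *v u | u. \<forall>j. 0 \<le> u $ j}"
proof
  have "convex_cone {A *v u | u. \<forall>j. 0 \<le> u $ j}"
    unfolding convex_cone_iff
  proof (intro conjI ballI allI impI)
    show "0 \<in> {A *v u | u. \<forall>j. 0 \<le> u $ j}"
      by (auto intro!: exI[of _ 0])
  next
    fix x y assume "x \<in> {A *v u | u. \<forall>j. 0 \<le> u $ j}" "y \<in> {A *v u | u. \<forall>j. 0 \<le> u $ j}"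
    then obtain u v where "x = A *v u" "\<forall>j. 0 \<le> u $ j" "y = A *v v" "\<forall>j. 0 \<le> v $ j"
      by blast
    then show "x + y \<in> {A *v u | u. \<forall>j. 0 \<le> u $ j}"
      by (auto intro!: exI[of _ "u + v"] simp: matrix_vector_right_distrib)
  next
    fix x and c :: real
    assume "x \<in> {A *v u | u. \<forall>j. 0 \<le> u $ j}" "0 \<le> c"
    then obtain u where "x = A *v u" "\<forall>j. 0 \<le> u $ j"
      by blast
    with \<open>0 \<le> c\<close> show "c *\<^sub>R x \<in> {A *v u | u. \<forall>j. 0 \<le> u $ j}"
      by (auto intro!: exI[of _ "c *\<^sub>R u"] simp: matrix_vector_mult_scaleR)
  qed
  moreover have "columns A \<subseteq> {A *v u | u. \<forall>j. 0 \<le> u $ j}"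
  proof
    fix x assume "x \<in> columns A"
    then obtain i where "x = column i A" by (auto simp: columns_def)
    then have "x = A *v axis i 1" by (simp add: matrix_vector_mult_basis)
    then show "x \<in> {A *v u | u. \<forall>j. 0 \<le> u $ j}"
      by (auto intro!: exI[of _ "axis i 1"] simp: axis_def)
  qed
  ultimately show "pos A \<subseteq> {A *v u | u. \<forall>j. 0 \<le> u $ j}"
    unfolding pos_def by (simp add: hull_minimal)
next
  have cc: "convex_cone (pos A)"
    unfolding pos_def by (rule convex_cone_convex_cone_hull)
  have "A *v u \<in> pos A" if u: "\<forall>j. 0 \<le> u $ j" for u
  proof -
    have "(\<Sum>j\<in>S. u $ j *\<^sub>R column j A) \<in> pos A" if "finite S" for S
      using that
    proof induction
      case empty
      show ?case using cc by (simp add: convex_cone_contains_0)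
    next
      case (insert j S)
      have "column j A \<in> pos A"
        unfolding pos_def by (rule hull_inc) (auto simp: columns_def)
      then show ?case
        using insert cc u by (simp add: convex_cone_add convex_cone_scaleR)
    qed
    from this[of UNIV] show ?thesis
      by (simp add: matrix_mult_sum scalar_mult_eq_scaleR)
  qed
  then show "{A *v u | u. \<forall>j. 0 \<le> u $ j} \<subseteq> pos A" by blast
qed

lemma orthant_iff:
  "x \<in> pos (compl_matrix (mat 1) \<alpha>) \<longleftrightarrow> (\<forall>j. if j \<in> \<alpha> then x $ j \<le> 0 else 0 \<le> x $ j)"
proof -
  have *: "compl_matrix (mat 1) \<alpha> *v u = (\<chi> i. if i \<in> \<alpha> then - u $ i else u $ i)" for u
  proof -
    have "(compl_matrix (mat 1) \<alpha> *v u) $ i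
        = (\<Sum>j\<in>UNIV. if i = j then (if i \<in> \<alpha> then - u $ i else u $ i) else 0)" for i
      unfolding matrix_vector_mult_def compl_matrix_def mat_def vec_lambda_beta
      by (rule sum.cong) auto
    then show ?thesis by (simp add: vec_eq_iff)
  qed
  show ?thesis
  proof
    assume "x \<in> pos (compl_matrix (mat 1) \<alpha>)"
    then show "\<forall>j. if j \<in> \<alpha> then x $ j \<le> 0 else 0 \<le> x $ j"
      by (auto simp: pos_eq *)
  next
    assume "\<forall>j. if j \<in> \<alpha> then x $ j \<le> 0 else 0 \<le> x $ j"
    then show "x \<in> pos (compl_matrix (mat 1) \<alpha>)"
      unfolding pos_eq mem_Collect_eq *
      by (intro exI[of _ "\<chi> i. if i \<in> \<alpha> then - x $ i else x $ i"])
         (auto simp: vec_eq_iff split: if_splits)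
  qed
qed

lemma lcp_map_eq:
  assumes "x \<in> pos (compl_matrix (mat 1) \<alpha>)"
  shows "lcp_map M x = compl_matrix (- M) \<alpha> *v x"
proof -
  have "compl_matrix (- M) \<alpha> *v x = compl_matrix (- M) \<beta> *v x"
    if \<beta>: "x \<in> pos (compl_matrix (mat 1) \<beta>)" for \<beta>
  proof -
    have "x $ j = 0" if "(j \<in> \<alpha>) \<noteq> (j \<in> \<beta>)" for j
      using assms \<beta> that unfolding orthant_iff by (metis order_antisym)
    then show ?thesis
      unfolding matrix_vector_mult_def compl_matrix_def vec_eq_iff vec_lambda_beta
      by (intro allI sum.cong) auto
  qed
  with assms show ?thesis
    unfolding lcp_map_def by (intro the_equality) blast+
qed

end

theory Submission
  imports Defs
begin

text \<open>
  Each linear piece of \<open>lcp_map M\<close> has as its \<open>j\<close>-th column either the unit vector \<open>e\<^sub>j\<close> or the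
  column \<open>M\<^sub>j\<close>. In the plane all pieces are thus described by four vectors
  \<open>e\<^sub>1, e\<^sub>2, M\<^sub>1, M\<^sub>2\<close>. The six determinants of pairs of these vectors are \<open>1\<close>, the entries
  of \<open>M\<close> up to sign, and \<open>det M\<close>; so the hypotheses say exactly that no two of the vectors are
  parallel and that the determinants of corresponding pairs for \<open>M\<close> and \<open>N\<close> have equal signs.

  It suffices to find a homeomorphism \<open>\<phi>\<close> of the plane that maps the line through each of
  \<open>e\<^sub>1, e\<^sub>2, N\<^sub>1, N\<^sub>2\<close> to the line through the corresponding one of \<open>e\<^sub>1, e\<^sub>2, M\<^sub>1, M\<^sub>2\<close> and
  each side of it to the corresponding side. By Cramer's rule the coordinates of a point
  with respect to two of the vectors have the signs that tell on which side of the two lines the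
  point lies, so \<open>\<phi>\<close> then preserves the signs of the coordinates with respect to every linear
  piece. Hence \<open>\<phi>\<close> can be lifted, orthant by orthant, to a homeomorphism \<open>\<psi>\<close> that preserves the
  sign of each coordinate (\<open>lift_along_lcp_map\<close>); such a \<open>\<psi>\<close> maps every orthant onto
  itself and induces the identity on the field of sets. This part works in every
  dimension (\<open>lcp_equivalent_if_sgn_preserving\<close>).

  A linear \<open>\<phi>\<close> can adjust three of the four lines; the cross ratio of the four lines is
  the obstruction to adjusting the fourth. Raising both coordinates with respect to two of the
  lines to a power \<open>p\<close>, signs kept, is a homeomorphism that maps lines through the origin to lines
  through the origin, respects sides, and raises a positive cross ratio to the power \<open>p\<close>. The
  sign conditions put the two cross ratios on the same side of \<open>1\<close>, so a suitable \<open>p > 0\<close>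
  exists. If the cross ratio is negative, exchanging two of the lines makes it positive
  (\<open>four_lines_homeomorphism\<close>).
\<close>

section \<open>Lifting a map of the range to the domain\<close>

lemma sgn_preserving_orthant:
  assumes "\<And>i. sgn (x $ i) = sgn (y $ i :: real)"
  shows "x \<in> pos (compl_matrix (mat 1) \<alpha>) \<longleftrightarrow> y \<in> pos (compl_matrix (mat 1) \<alpha>)"
proof -
  have "x $ j \<le> 0 \<longleftrightarrow> y $ j \<le> 0" "0 \<le> x $ j \<longleftrightarrow> 0 \<le> y $ j" for j
    using assms[of j] by (auto simp: sgn_if split: if_splits)
  then show ?thesis unfolding orthant_iff by simp
qed

lemma in_own_orthant: "x \<in> pos (compl_matrix (mat 1) {i. x $ i < 0})"
  by (auto simp: orthant_iff)

lemma lcp_map_inj_on_orthant: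
  assumes "\<And>\<alpha>. invertible (compl_matrix (- M) \<alpha>)"
    and "x \<in> pos (compl_matrix (mat 1) \<alpha>)" "y \<in> pos (compl_matrix (mat 1) \<alpha>)"
    and "lcp_map M x = lcp_map M y"
  shows "x = y"
proof -
  have "compl_matrix (- M) \<alpha> *v x = compl_matrix (- M) \<alpha> *v y"
    using assms(2-4) by (simp add: lcp_map_eq)
  then show ?thesis
    using assms(1) by (metis invertible_def matrix_vector_mul_assoc matrix_vector_mul_lid)
qed

lemma closed_orthant: "closed (pos (compl_matrix (mat 1) \<alpha>))"
proof -
  have eq: "pos (compl_matrix (mat 1) \<alpha>) = (\<Inter>j. {x. if j \<in> \<alpha> then x $ j \<le> 0 else 0 \<le> x $ j})"
    unfolding orthant_iff set_eq_iff by simp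
  have "closed {x :: real^'a. if j \<in> \<alpha> then x $ j \<le> 0 else 0 \<le> x $ j}" for j
    by (cases "j \<in> \<alpha>") (simp_all add: closed_Collect_le continuous_on_component)
  then show ?thesis unfolding eq by (intro closed_INT) blast
qed

text \<open>
  On the orthant \<open>\<alpha>\<close> the lift must be \<open>C\<^bsub>-N\<^esub>(\<alpha>)\<^sup>-\<^sup>1 \<circ> \<phi> \<circ> C\<^bsub>-M\<^esub>(\<alpha>)\<close>, where \<open>C\<^bsub>-M\<^esub>(\<alpha>)\<close> and \<open>C\<^bsub>-N\<^esub>(\<alpha>)\<close>
  are the linear pieces of the two maps. The sign condition makes each of these formulas preserve
  all orthants. On an overlap of two orthants both formulas therefore give points of the same
  orthant with the same image under \<open>lcp_map N\<close>, and injectivity there makes them agree.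
\<close>

lemma lift_along_lcp_map:
  fixes M N :: "real^'n^'n"
  assumes cont: "continuous_on UNIV \<phi>"
    and inv: "\<And>\<alpha>. invertible (compl_matrix (- N) \<alpha>)"
    and sgn: "\<And>\<alpha> u v i. compl_matrix (- N) \<alpha> *v v = \<phi> (compl_matrix (- M) \<alpha> *v u)
                \<Longrightarrow> sgn (v $ i) = sgn (u $ i)"
  shows "\<exists>\<psi>. continuous_on UNIV \<psi> \<and> (\<forall>x i. sgn (\<psi> x $ i) = sgn (x $ i)) \<and>
             (\<forall>x. lcp_map N (\<psi> x) = \<phi> (lcp_map M x))"
proof -
  obtain B where B: "\<And>\<alpha>. compl_matrix (- N) \<alpha> ** B \<alpha> = mat 1"
    using inv unfolding invertible_def by metis
  define piece where "piece \<alpha> x = B \<alpha> *v \<phi> (compl_matrix (- M) \<alpha> *v x)" for \<alpha> x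
  define \<psi> where "\<psi> x = piece {i. x $ i < 0} x" for x
  have piece: "compl_matrix (- N) \<alpha> *v piece \<alpha> x = \<phi> (compl_matrix (- M) \<alpha> *v x)" for \<alpha> x
    by (simp add: piece_def matrix_vector_mul_assoc B)
  have piece_sgn: "sgn (piece \<alpha> x $ i) = sgn (x $ i)" for \<alpha> x i
    using sgn[OF piece] .
  have piece_lcp: "lcp_map N (piece \<alpha> x) = \<phi> (lcp_map M x)"
    if "x \<in> pos (compl_matrix (mat 1) \<alpha>)" for \<alpha> x
  proof -
    have "piece \<alpha> x \<in> pos (compl_matrix (mat 1) \<alpha>)"
      using that sgn_preserving_orthant[of "piece \<alpha> x" x \<alpha>] piece_sgn by simp
    then show ?thesis using that piece by (simp add: lcp_map_eq)
  qed
  have \<psi>_piece: "\<psi> x = piece \<alpha> x" if "x \<in> pos (compl_matrix (mat 1) \<alpha>)" for \<alpha> x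
  proof (rule lcp_map_inj_on_orthant[OF inv])
    show "lcp_map N (\<psi> x) = lcp_map N (piece \<alpha> x)"
      unfolding \<psi>_def using piece_lcp[OF in_own_orthant] piece_lcp[OF that] by simp
    show "\<psi> x \<in> pos (compl_matrix (mat 1) \<alpha>)" "piece \<alpha> x \<in> pos (compl_matrix (mat 1) \<alpha>)"
      unfolding \<psi>_def
      using that sgn_preserving_orthant[of "piece _ x" x \<alpha>] piece_sgn by simp_all
  qed
  have "continuous_on (pos (compl_matrix (mat 1) \<alpha>)) \<psi>" for \<alpha>
  proof (rule continuous_on_eq)
    show "continuous_on (pos (compl_matrix (mat 1) \<alpha>)) (piece \<alpha>)"
      unfolding piece_def
      by (intro continuous_intros continuous_on_compose2[OF cont] matrix_vector_mult_linear_continuous_on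
          continuous_on_compose2[OF matrix_vector_mult_linear_continuous_on]) auto
  qed (simp add: \<psi>_piece)
  then have "continuous_on (\<Union>\<alpha>\<in>UNIV. pos (compl_matrix (mat 1) \<alpha>)) \<psi>"
    by (intro continuous_on_closed_Union) (auto intro: closed_orthant)
  moreover have "(\<Union>\<alpha>\<in>UNIV. pos (compl_matrix (mat 1) \<alpha>)) = (UNIV :: (real^'n) set)"
    using in_own_orthant by blast
  ultimately have "continuous_on UNIV \<psi>" by simp
  moreover have "sgn (\<psi> x $ i) = sgn (x $ i)" for x i
    by (simp add: \<psi>_def piece_sgn)
  moreover have "lcp_map N (\<psi> x) = \<phi> (lcp_map M x)" for x
    unfolding \<psi>_def by (rule piece_lcp[OF in_own_orthant])
  ultimately show ?thesis by blast
qed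

text \<open>
  The sets that equal their own preimage form an algebra. It contains the orthants, hence the field
  they generate, so the induced automorphism is the identity.
\<close>

lemma sgn_preserving_induces_automorphism:
  fixes \<psi> :: "real^'n \<Rightarrow> real^'n"
  assumes "\<And>x i. sgn (\<psi> x $ i) = sgn (x $ i)"
  shows "induces_automorphism \<psi> orthant_field"
proof -
  have "algebra UNIV {P. \<psi> -` P = P}"
    unfolding algebra_iff_Un by auto
  moreover have "orthants \<subseteq> {P. \<psi> -` P = P}"
    using sgn_preserving_orthant[of "\<psi> _"] assms by (auto simp: orthants_def)
  ultimately have "orthant_field \<subseteq> {P. \<psi> -` P = P}"
    unfolding orthant_field_def generated_field_def by (simp add: hull_minimal)
  then show ?thesis
    unfolding induces_automorphism_def boolean_automorphism_def
    by (intro exI[of _ id]) auto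
qed

text \<open>
  The homeomorphism of the domain and its inverse are lifts of \<open>\<phi>'\<close> and \<open>\<phi>\<close>. That they are
  inverse to each other follows from injectivity on orthants: their composites preserve orthants and
  the values of the map.
\<close>

lemma lcp_equivalent_if_sgn_preserving:
  fixes M N :: "real^'n^'n"
  assumes homeo: "homeomorphism UNIV UNIV \<phi> \<phi>'"
    and inv: "\<And>\<alpha>. invertible (compl_matrix (- M) \<alpha>)" "\<And>\<alpha>. invertible (compl_matrix (- N) \<alpha>)"
    and sgn: "\<And>\<alpha> u v i. \<phi> (compl_matrix (- N) \<alpha> *v v) = compl_matrix (- M) \<alpha> *v u
                \<Longrightarrow> sgn (u $ i) = sgn (v $ i)"
  shows "lcp_equivalent M N"
proof -
  have \<phi>: "continuous_on UNIV \<phi>" "continuous_on UNIV \<phi>'" "\<And>y. \<phi> (\<phi>' y) = y" "\<And>y. \<phi>' (\<phi> y) = y"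
    using homeo by (auto simp: homeomorphism_def)
  obtain \<psi> where \<psi>: "continuous_on UNIV \<psi>" "\<And>x i. sgn (\<psi> x $ i) = sgn (x $ i)"
      "\<And>x. lcp_map N (\<psi> x) = \<phi>' (lcp_map M x)"
    using lift_along_lcp_map[OF \<phi>(2) inv(2), of M] sgn \<phi>(3) by metis
  obtain \<psi>' where \<psi>': "continuous_on UNIV \<psi>'" "\<And>x i. sgn (\<psi>' x $ i) = sgn (x $ i)"
      "\<And>x. lcp_map M (\<psi>' x) = \<phi> (lcp_map N x)"
    using lift_along_lcp_map[OF \<phi>(1) inv(1), of N] sgn by metis
  have same_orthant: "y \<in> pos (compl_matrix (mat 1) {i. x $ i < 0})"
    if "\<And>i. sgn (y $ i) = sgn (x $ i)" for x y :: "real^'n"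
    using sgn_preserving_orthant[OF that] in_own_orthant by blast
  have "\<psi>' (\<psi> x) = x" for x
    by (rule lcp_map_inj_on_orthant[OF inv(1) same_orthant in_own_orthant]) (simp_all add: \<psi> \<psi>' \<phi>)
  moreover have "\<psi> (\<psi>' x) = x" for x
    by (rule lcp_map_inj_on_orthant[OF inv(2) same_orthant in_own_orthant]) (simp_all add: \<psi> \<psi>' \<phi>)
  ultimately have "homeomorphism UNIV UNIV \<psi> \<psi>'"
    using \<psi>(1) \<psi>'(1) by (auto simp: homeomorphism_def image_iff) metis+
  moreover have "lcp_map M = \<phi> \<circ> lcp_map N \<circ> \<psi>"
    by (simp add: fun_eq_iff \<psi>(3) \<phi>(3))
  ultimately show ?thesis
    unfolding lcp_equivalent_def
    using homeo sgn_preserving_induces_automorphism[of \<psi>] \<psi>(2) by blast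
qed

section \<open>Signed powers\<close>

definition signed_powr :: "real \<Rightarrow> real \<Rightarrow> real" where
  "signed_powr p x = sgn x * \<bar>x\<bar> powr p"

lemma signed_powr_mult: "signed_powr p (x * y) = signed_powr p x * signed_powr p y"
  by (simp add: signed_powr_def sgn_mult abs_mult powr_mult)

lemma sgn_signed_powr [simp]: "sgn (signed_powr p x) = sgn x"
  by (auto simp: signed_powr_def sgn_mult sgn_if)

lemma signed_powr_eq_0_iff [simp]: "signed_powr p x = 0 \<longleftrightarrow> x = 0"
  by (auto simp: signed_powr_def sgn_eq_0_iff)

lemma signed_powr_inverse: "p > 0 \<Longrightarrow> signed_powr (1 / p) (signed_powr p x) = x"
  by (auto simp: signed_powr_def sgn_mult abs_mult powr_powr sgn_if)

lemma continuous_on_signed_powr: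
  assumes "p > 0"
  shows "continuous_on UNIV (signed_powr p)"
proof -
  have "signed_powr p = (\<lambda>x. max x 0 powr p - max (- x) 0 powr p)"
    by (auto simp: signed_powr_def fun_eq_iff sgn_if max_def)
  then show ?thesis
    using assms by (auto intro!: continuous_intros continuous_on_powr')
qed

lemma signed_powr_less:
  assumes "p > 0" "x < y"
  shows "signed_powr p x < signed_powr p y"
proof -
  consider "0 \<le> x" | "x < 0" "0 \<le> y" | "y < 0" using assms by linarith
  then show ?thesis
  proof cases
    case 1
    then show ?thesis using assms by (auto simp: signed_powr_def sgn_if intro: powr_less_mono2)
  next
    case 2
    then show ?thesis
      by (smt (verit) sgn_signed_powr sgn_if)
  next
    case 3
    then show ?thesis using assms by (auto simp: signed_powr_def sgn_if intro: powr_less_mono2)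
  qed
qed

lemma sgn_signed_powr_diff:
  "p > 0 \<Longrightarrow> sgn (signed_powr p x - signed_powr p y) = sgn (x - y)"
  using signed_powr_less[of p x y] signed_powr_less[of p y x]
  by (cases x y rule: linorder_cases) (auto simp: sgn_if)

section \<open>Four lines through the origin of the plane\<close>

text \<open>
  The value \<open>area u y\<close> is positive, zero or negative as \<open>y\<close> lies to the left of, on, or to the
  right of the line through \<open>0\<close> directed by \<open>u\<close>.
\<close>

definition area :: "real^2 \<Rightarrow> real^2 \<Rightarrow> real" where
  "area u v = u $ 1 * v $ 2 - u $ 2 * v $ 1"

lemma area_swap: "area u v = - area v u"
  by (simp add: area_def)

text \<open>
  The three-term Grassmann-Pluecker relation.
\<close>

lemma area_relation: "area a b * area c d = area a c * area b d - area b c * area a d"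
  by (simp add: area_def algebra_simps)

lemma area_lincomb [simp]:
  "area u ((s *\<^sub>R v - t *\<^sub>R w) /\<^sub>R c) = (s * area u v - t * area u w) / c"
  by (simp add: area_def divide_inverse algebra_simps)

lemma area_expand:
  assumes "area u v \<noteq> 0"
  shows "(area u y *\<^sub>R v - area v y *\<^sub>R u) /\<^sub>R area u v = y"
proof -
  have "area u y *\<^sub>R v - area v y *\<^sub>R u = area u v *\<^sub>R y"
    by (simp add: vec_eq_iff forall_2 area_def algebra_simps)
  then show ?thesis using assms by simp
qed

lemma powr_interpolation:
  fixes q r :: real
  assumes "q > 0" "r > 0" "sgn (1 - q) = sgn (1 - r)" "q \<noteq> 1"
  obtains p where "p > 0" "q powr p = r"
proof
  have r: "r \<noteq> 1" using assms by (auto simp: sgn_if split: if_splits)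
  show "ln r / ln q > 0"
    using assms r by (auto simp: sgn_if zero_less_divide_iff split: if_splits)
  show "q powr (ln r / ln q) = r"
    using assms r by (simp add: powr_def)
qed

text \<open>
  The coordinates used are \<open>area u1\<close> and \<open>area u2\<close>. The homeomorphism applies \<open>signed_powr p\<close> to
  both, multiplies the second by \<open>k\<close>, and reads the result as \<open>area w1\<close> and \<open>area w2\<close>.
  By \<open>area_relation\<close> the third and the fourth form are linear combinations of these two, and
  since \<open>signed_powr p\<close> is multiplicative and increasing, the sign of a difference \<open>a * x - b * y\<close>
  is that of \<open>signed_powr p a * signed_powr p x - signed_powr p b * signed_powr p y\<close>. The third
  line thus dictates one value of \<open>k\<close> and the fourth another. They agree exactly if \<open>p\<close> turns
  the cross ratio \<open>q\<close> of the first four lines into the cross ratio \<open>r\<close> of the other four.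
\<close>

lemma four_lines_homeomorphism_cross_ratio_pos:
  fixes u1 u2 u3 u4 w1 w2 w3 w4 :: "real^2"
  assumes nz: "area u1 u2 \<noteq> 0" "area u1 u3 \<noteq> 0" "area u1 u4 \<noteq> 0"
      "area u2 u3 \<noteq> 0" "area u2 u4 \<noteq> 0" "area u3 u4 \<noteq> 0"
    and sg: "sgn (area u1 u2) = sgn (area w1 w2)" "sgn (area u1 u3) = sgn (area w1 w3)"
      "sgn (area u1 u4) = sgn (area w1 w4)" "sgn (area u2 u3) = sgn (area w2 w3)"
      "sgn (area u2 u4) = sgn (area w2 w4)" "sgn (area u3 u4) = sgn (area w3 w4)"
    and pos: "area u2 u3 * area u1 u4 * (area u1 u3 * area u2 u4) > 0"
  shows "\<exists>\<phi> \<phi>'. homeomorphism UNIV UNIV \<phi> \<phi>' \<and>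
    (\<forall>y. \<forall>(u, w) \<in> {(u1, w1), (u2, w2), (u3, w3), (u4, w4)}. sgn (area w (\<phi> y)) = sgn (area u y))"
proof -
  have nzw: "area w1 w2 \<noteq> 0" "area w1 w3 \<noteq> 0" "area w1 w4 \<noteq> 0"
      "area w2 w3 \<noteq> 0" "area w2 w4 \<noteq> 0" "area w3 w4 \<noteq> 0"
    using nz sg by (metis sgn_zero_iff)+
  define q where "q = area u2 u3 * area u1 u4 / (area u1 u3 * area u2 u4)"
  define r where "r = area w2 w3 * area w1 w4 / (area w1 w3 * area w2 w4)"
  \<comment> \<open>These formulas put \<open>q\<close> and \<open>r\<close> on the same side of \<open>1\<close>.\<close>
  have q1: "1 - q = area u1 u2 * area u3 u4 / (area u1 u3 * area u2 u4)"
    using nz by (simp add: q_def area_relation[of u1 u2 u3 u4] field_simps)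
  have r1: "1 - r = area w1 w2 * area w3 w4 / (area w1 w3 * area w2 w4)"
    using nzw by (simp add: r_def area_relation[of w1 w2 w3 w4] field_simps)
  have "q > 0" using pos by (simp add: q_def zero_less_divide_iff zero_less_mult_iff)
  moreover have "sgn q = sgn r" by (simp add: q_def r_def sgn_mult sgn_divide sg)
  moreover have "sgn (1 - q) = sgn (1 - r)" by (simp add: q1 r1 sgn_mult sgn_divide sg)
  moreover have "q \<noteq> 1" using q1 nz by auto
  ultimately obtain p where p: "p > 0" "q powr p = r"
    using powr_interpolation[of q r] by (metis sgn_1_pos sgn_pos)
  let ?P = "signed_powr p" and ?Q = "signed_powr (1 / p)"
  have r: "r = ?P q" using p \<open>q > 0\<close> by (simp add: signed_powr_def)
  \<comment> \<open>The value dictated by the third line; \<open>k4\<close> is the one dictated by the fourth.\<close>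
  define k where "k = area w2 w3 * ?P (area u1 u3) / (area w1 w3 * ?P (area u2 u3))"
  have k4: "k = area w2 w4 * ?P (area u1 u4) / (area w1 w4 * ?P (area u2 u4))"
  proof -
    have "r * ?P (area u1 u3 * area u2 u4) = ?P (area u2 u3 * area u1 u4)"
      unfolding r signed_powr_mult[symmetric] using nz by (simp add: q_def)
    then show ?thesis
      using nz nzw unfolding k_def r_def by (simp add: signed_powr_mult field_simps)
  qed
  have "sgn k = 1"
    using nz nzw unfolding k_def by (simp add: sgn_mult sgn_divide sg) (auto simp: sgn_if)
  then have k: "k > 0" by (simp add: sgn_1_pos)
  define \<phi> where
    "\<phi> y = (?P (area u1 y) *\<^sub>R w2 - (k * ?P (area u2 y)) *\<^sub>R w1) /\<^sub>R area w1 w2" for y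
  define \<phi>' where
    "\<phi>' z = (?Q (area w1 z) *\<^sub>R u2 - ?Q (area w2 z / k) *\<^sub>R u1) /\<^sub>R area u1 u2" for z
  have \<phi>1: "area w1 (\<phi> y) = ?P (area u1 y)" and \<phi>2: "area w2 (\<phi> y) = k * ?P (area u2 y)" for y
    using nzw area_swap[of w2 w1] by (simp_all add: \<phi>_def) (simp_all add: area_def)
  have \<phi>'1: "area u1 (\<phi>' z) = ?Q (area w1 z)" and \<phi>'2: "area u2 (\<phi>' z) = ?Q (area w2 z / k)" for z
    using nz area_swap[of u2 u1] by (simp_all add: \<phi>'_def) (simp_all add: area_def)
  have QP: "?Q (?P x) = x" and PQ: "?P (?Q x) = x" for x
    using signed_powr_inverse[of p] signed_powr_inverse[of "1 / p"] p by simp_all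
  have "\<phi>' (\<phi> y) = y" for y
    using k nz area_expand[of u1 u2 y] by (simp add: \<phi>'_def \<phi>1 \<phi>2 QP)
  moreover have "\<phi> (\<phi>' z) = z" for z
    using k nzw area_expand[of w1 w2 z] by (simp add: \<phi>_def \<phi>'1 \<phi>'2 PQ)
  moreover have cont_area: "continuous_on UNIV (area u)" for u
    unfolding area_def by (intro continuous_intros)
  have "continuous_on UNIV \<phi>" "continuous_on UNIV \<phi>'"
    unfolding \<phi>_def \<phi>'_def using p k
    by (auto intro!: continuous_intros cont_area
        continuous_on_compose2[OF continuous_on_signed_powr[of p]]
        continuous_on_compose2[OF continuous_on_signed_powr[of "1 / p"]])
  ultimately have homeo: "homeomorphism UNIV UNIV \<phi> \<phi>'"
    by (auto simp: homeomorphism_def image_iff) metis+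
  have sgn_other: "sgn (area w (\<phi> y)) = sgn (area u y)"
    if k: "k = area w2 w * ?P (area u1 u) / (area w1 w * ?P (area u2 u))"
      and nz': "area u1 u \<noteq> 0" "area u2 u \<noteq> 0" "area w1 w \<noteq> 0"
      and sg': "sgn (area u2 u) = sgn (area w2 w)" for u w y
  proof -
    define l where "l = area w2 w / ?P (area u2 u)"
    have "sgn l = 1"
      using nz' by (simp add: l_def sgn_divide sg'[symmetric]) (auto simp: sgn_if)
    have "area w1 w2 * area w (\<phi> y)
        = area w1 w * (k * ?P (area u2 y)) - area w2 w * ?P (area u1 y)"
      unfolding area_relation[of w1 w2] \<phi>1 \<phi>2 ..
    also have "\<dots> = l * (?P (area u1 u * area u2 y) - ?P (area u2 u * area u1 y))"
      unfolding k l_def using nz' by (simp add: signed_powr_mult field_simps)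
    finally have "sgn (area w1 w2 * area w (\<phi> y))
        = sgn (area u1 u * area u2 y - area u2 u * area u1 y)"
      using \<open>sgn l = 1\<close> p by (simp add: sgn_mult sgn_signed_powr_diff)
    also have "\<dots> = sgn (area u1 u2 * area u y)"
      by (simp only: area_relation[of u1 u2])
    finally show ?thesis
      using nzw(1) by (simp add: sgn_mult sg(1) sgn_eq_0_iff)
  qed
  have "sgn (area w3 (\<phi> y)) = sgn (area u3 y)" for y
    using sgn_other[OF k_def] nz nzw sg by simp
  moreover have "sgn (area w4 (\<phi> y)) = sgn (area u4 y)" for y
    using sgn_other[OF k4] nz nzw sg by simp
  moreover have "sgn (area w1 (\<phi> y)) = sgn (area u1 y)" "sgn (area w2 (\<phi> y)) = sgn (area u2 y)" for y
    using k by (simp_all add: \<phi>1 \<phi>2 sgn_mult)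
  ultimately show ?thesis using homeo by (intro exI[of _ \<phi>] exI[of _ \<phi>']) simp
qed

text \<open>
  In \<open>area_relation\<close> the product on the left is the difference of the two on the right. If
  these have opposite signs, the left one has a sign that makes the cross ratio positive after
  exchanging the second and the third line.
\<close>

lemma four_lines_homeomorphism:
  fixes u1 u2 u3 u4 w1 w2 w3 w4 :: "real^2"
  assumes nz: "area u1 u2 \<noteq> 0" "area u1 u3 \<noteq> 0" "area u1 u4 \<noteq> 0"
      "area u2 u3 \<noteq> 0" "area u2 u4 \<noteq> 0" "area u3 u4 \<noteq> 0"
    and sg: "sgn (area u1 u2) = sgn (area w1 w2)" "sgn (area u1 u3) = sgn (area w1 w3)"
      "sgn (area u1 u4) = sgn (area w1 w4)" "sgn (area u2 u3) = sgn (area w2 w3)"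
      "sgn (area u2 u4) = sgn (area w2 w4)" "sgn (area u3 u4) = sgn (area w3 w4)"
  shows "\<exists>\<phi> \<phi>'. homeomorphism UNIV UNIV \<phi> \<phi>' \<and>
    (\<forall>y. \<forall>(u, w) \<in> {(u1, w1), (u2, w2), (u3, w3), (u4, w4)}. sgn (area w (\<phi> y)) = sgn (area u y))"
proof (cases "area u2 u3 * area u1 u4 * (area u1 u3 * area u2 u4) > 0")
  case True
  then show ?thesis using four_lines_homeomorphism_cross_ratio_pos[OF assms] by blast
next
  case False
  have "area u3 u2 * area u1 u4 * (area u1 u2 * area u3 u4) > 0"
  proof -
    define a b where "a = area u2 u3 * area u1 u4" and "b = area u1 u3 * area u2 u4"
    have "a * b < 0" using False nz unfolding a_def b_def by (simp add: less_le)
    then have "a * (b - a) < 0"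
      by (simp add: algebra_simps) (smt (verit) zero_le_square)
    moreover have "area u1 u2 * area u3 u4 = b - a"
      unfolding a_def b_def by (rule area_relation)
    ultimately show ?thesis
      by (simp add: area_swap[of u3 u2] a_def[symmetric])
  qed
  then have "\<exists>\<phi> \<phi>'. homeomorphism UNIV UNIV \<phi> \<phi>' \<and>
      (\<forall>y. \<forall>(u, w) \<in> {(u1, w1), (u3, w3), (u2, w2), (u4, w4)}.
         sgn (area w (\<phi> y)) = sgn (area u y))"
    using assms
    by (intro four_lines_homeomorphism_cross_ratio_pos)
       (simp_all add: area_swap[of u3 u2] area_swap[of w3 w2] sgn_minus)
  then show ?thesis by (simp add: insert_commute)
qed

section \<open>Planar matrices\<close>

lemma det_eq_area: "det A = area (column 1 A) (column 2 A)" for A :: "real^2^2"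
  by (simp add: det_2 area_def column_def)

lemma area_column_mult:
  fixes A :: "real^2^2"
  shows "area (column 1 A) (A *v x) = det A * x $ 2" "area (column 2 A) (A *v x) = - det A * x $ 1"
  by (simp_all add: det_2 area_def column_def matrix_vector_mult_def sum_2 algebra_simps)

lemma column_compl_matrix:
  "column j (compl_matrix (- M) \<alpha>) = (if j \<in> \<alpha> then column j M else axis j 1)"
  by (auto simp: compl_matrix_def column_def vec_eq_iff mat_def axis_def)

theorem theorem19:
  fixes M N :: "real^2^2"
  assumes "M $ 1 $ 2 * N $ 1 $ 2 > 0"
    and "M $ 2 $ 1 * N $ 2 $ 1 > 0"
    and "\<forall>\<alpha>. principal_minor M \<alpha> * principal_minor N \<alpha> > 0"
  shows "lcp_equivalent M N"
proof -
  have sgn_eq: "sgn a = sgn b \<and> a \<noteq> 0 \<and> b \<noteq> 0" if "a * b > 0" for a b :: real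
    using that by (auto simp: zero_less_mult_iff)
  have entries: "sgn (N $ 1 $ 2) = sgn (M $ 1 $ 2)" "N $ 1 $ 2 \<noteq> 0"
      "sgn (N $ 2 $ 1) = sgn (M $ 2 $ 1)" "N $ 2 $ 1 \<noteq> 0"
      "sgn (N $ 1 $ 1) = sgn (M $ 1 $ 1)" "N $ 1 $ 1 \<noteq> 0"
      "sgn (N $ 2 $ 2) = sgn (M $ 2 $ 2)" "N $ 2 $ 2 \<noteq> 0"
      "sgn (det N) = sgn (det M)" "det N \<noteq> 0"
    using sgn_eq[OF assms(1)] sgn_eq[OF assms(2)]
      sgn_eq[OF assms(3)[rule_format, of "{1}"]] sgn_eq[OF assms(3)[rule_format, of "{2}"]]
      sgn_eq[OF assms(3)[rule_format, of UNIV]]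
    by (simp_all add: principal_minor_singleton principal_minor_UNIV)
  let ?e1 = "axis 1 1 :: real^2" and ?e2 = "axis 2 1 :: real^2"
  \<comment> \<open>The pairwise areas of the four vectors are, up to sign, the quantities in the hypotheses.\<close>
  have areas: "area ?e1 ?e2 = 1"
      "area ?e1 (column 1 A) = A $ 2 $ 1" "area ?e1 (column 2 A) = A $ 2 $ 2"
      "area ?e2 (column 1 A) = - A $ 1 $ 1" "area ?e2 (column 2 A) = - A $ 1 $ 2"
      "area (column 1 A) (column 2 A) = det A" for A :: "real^2^2"
    by (simp_all add: area_def column_def axis_def det_2)
  have "\<exists>\<phi> \<phi>'. homeomorphism UNIV UNIV \<phi> \<phi>' \<and>
    (\<forall>y. \<forall>(u, w) \<in> {(?e1, ?e1), (?e2, ?e2), (column 1 N, column 1 M), (column 2 N, column 2 M)}.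
       sgn (area w (\<phi> y)) = sgn (area u y))"
    by (rule four_lines_homeomorphism) (simp_all only: areas, simp_all add: entries sgn_minus)
  then obtain \<phi> \<phi>' where homeo: "homeomorphism UNIV UNIV \<phi> \<phi>'" and
    lines: "\<forall>j y. sgn (area (axis j 1) (\<phi> y)) = sgn (area (axis j 1) y)"
      "\<forall>j y. sgn (area (column j M) (\<phi> y)) = sgn (area (column j N) y)"
    unfolding forall_2 by auto
  have sgn_column: "sgn (area (column j (compl_matrix (- M) \<alpha>)) (\<phi> y))
      = sgn (area (column j (compl_matrix (- N) \<alpha>)) y)" for \<alpha> j y
    using lines by (simp add: column_compl_matrix)
  have sgn_det: "sgn (det (compl_matrix (- M) \<alpha>)) = sgn (det (compl_matrix (- N) \<alpha>))"
      and det_nz: "det (compl_matrix (- N) \<alpha>) \<noteq> 0" for \<alpha>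
    unfolding det_eq_area column_compl_matrix
    using entries areas area_swap[of _ ?e2] by (auto simp: sgn_minus)
  show ?thesis
  proof (rule lcp_equivalent_if_sgn_preserving[OF homeo])
    show "invertible (compl_matrix (- N) \<alpha>)" "invertible (compl_matrix (- M) \<alpha>)" for \<alpha>
      using det_nz sgn_det by (metis invertible_det_nz sgn_zero_iff)+
    fix \<alpha> u v i
    assume *: "\<phi> (compl_matrix (- N) \<alpha> *v v) = compl_matrix (- M) \<alpha> *v u"
    \<comment> \<open>Cramer's rule: up to the determinant, coordinates are areas with the other column.\<close>
    have "sgn (det (compl_matrix (- N) \<alpha>)) * sgn (u $ j) = sgn (det (compl_matrix (- N) \<alpha>)) * sgn (v $ j)" for j
      using sgn_column[of 1 \<alpha> "compl_matrix (- N) \<alpha> *v v"]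
        sgn_column[of 2 \<alpha> "compl_matrix (- N) \<alpha> *v v"] exhaust_2[of j]
      unfolding * area_column_mult by (auto simp: sgn_mult sgn_det sgn_minus)
    then show "sgn (u $ i) = sgn (v $ i)"
      using det_nz by (simp add: sgn_zero_iff)
  qed
qed

end
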